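(* Let $G$ be a group whose subgroup graph $\mathcal{L}(G)$ is connected and outer-planar. Then $G$ is isomorphic to $\mathbb{Z}_{p^m}$ or $\mathbb{Z}_{p^mq}$ for some distinct primes $p$ and $q$ and some non-negative integer $m$.
   Context: For a group $G$, the subgroup graph $\mathcal{L}(G)$ is the graph whose vertices are all subgroups of $G$, two subgroups $H,K$ being adjacent if one of them is a maximal subgroup of the other. A graph is outer-planar if it has a planar embedding in which every vertex lies on the boundary of the unbounded face. $\mathbb{Z}_n$ denotes the cyclic group of order $n$. *)

theory Defs
  imports "HOL-Analysis.Analysis" "HOL-Algebra.Algebra"
begin

definition maximal_subgroup_of :: "('a, 'b) monoid_scheme \<Rightarrow> 'a set \<Rightarrow> 'a set \<Rightarrow> bool" where
  "maximal_subgroup_of G H K \<longleftrightarrow>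
     subgroup H G \<and> subgroup K G \<and> H \<subset> K \<and>
     \<not> (\<exists>L. subgroup L G \<and> H \<subset> L \<and> L \<subset> K)"

definition subgroup_graph_vertices :: "('a, 'b) monoid_scheme \<Rightarrow> 'a set set" where
  "subgroup_graph_vertices G = {H. subgroup H G}"

definition subgroup_graph_edges :: "('a, 'b) monoid_scheme \<Rightarrow> 'a set set set" where
  "subgroup_graph_edges G =
     {{H, K} | H K. maximal_subgroup_of G H K \<or> maximal_subgroup_of G K H}"

definition graph_connected :: "'v set \<Rightarrow> 'v set set \<Rightarrow> bool" where
  "graph_connected V E \<longleftrightarrow>
     (\<forall>u\<in>V. \<forall>v\<in>V. (\<lambda>x y. {x, y} \<in> E)\<^sup>*\<^sup>* u v)"

definition planar_embedding ::
    "'v set \<Rightarrow> 'v set set \<Rightarrow> ('v \<Rightarrow> complex) \<Rightarrow> ('v set \<Rightarrow> real \<Rightarrow> complex) \<Rightarrow> bool" where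
  "planar_embedding V E f \<gamma> \<longleftrightarrow>
     inj_on f V \<and>
     (\<forall>e\<in>E. \<exists>u v. e = {u, v} \<and> u \<noteq> v \<and> u \<in> V \<and> v \<in> V \<and>
        arc (\<gamma> e) \<and> {pathstart (\<gamma> e), pathfinish (\<gamma> e)} = {f u, f v}) \<and>
     (\<forall>e\<in>E. \<forall>w\<in>V. w \<notin> e \<longrightarrow> f w \<notin> path_image (\<gamma> e)) \<and>
     (\<forall>e1\<in>E. \<forall>e2\<in>E. e1 \<noteq> e2 \<longrightarrow>
        path_image (\<gamma> e1) \<inter> path_image (\<gamma> e2) \<subseteq> f ` (e1 \<inter> e2))"

definition drawing :: "'v set \<Rightarrow> 'v set set \<Rightarrow> ('v \<Rightarrow> complex) \<Rightarrow> ('v set \<Rightarrow> real \<Rightarrow> complex) \<Rightarrow> complex set" where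
  "drawing V E f \<gamma> = f ` V \<union> (\<Union>e\<in>E. path_image (\<gamma> e))"

definition outer_planar :: "'v set \<Rightarrow> 'v set set \<Rightarrow> bool" where
  "outer_planar V E \<longleftrightarrow>
     (\<exists>f \<gamma> x. planar_embedding V E f \<gamma> \<and> x \<notin> drawing V E f \<gamma> \<and>
        \<not> bounded (connected_component_set (- drawing V E f \<gamma>) x) \<and>
        (\<forall>v\<in>V. f v \<in> frontier (connected_component_set (- drawing V E f \<gamma>) x)))"

end

theory Submission
  imports Defs "HOL-Library.Transitive_Closure_Table"
begin

text \<open>An outer-planar graph contains no three internally disjoint paths of length at least two between
  the same two vertices: by the Jordan curve theorem and Janiszewski's theorem, the outer face cannot
  reach all three arcs of a theta curve. In the subgroup graph such a configuration arises from any three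
  finite maximal subgroups of the same subgroup \<open>K\<close>. If \<open>H\<close> is finite and maximal in \<open>K\<close>, its conjugates
  in \<open>K\<close> are therefore at most two, which forces \<open>K\<close> to be finite; along a path from the trivial
  subgroup to \<open>G\<close> this makes \<open>G\<close> finite. Having at most two maximal subgroups, \<open>G\<close> is cyclic and its
  order has at most two prime divisors. If the squares of both of them divided the order, the subgroup
  graph would contain a 3 by 3 grid and hence a theta curve.\<close>

section \<open>Theta curves in the plane\<close>

text \<open>Joining \<open>c\<close> with the reverse of \<open>d\<close> gives a simple closed
  curve with image \<open>J\<close>. This is the Jordan curve theorem in the form that suits the
  three cycles of a theta curve.\<close>

lemma Jordan_two_arcs:
  fixes c d :: "real \<Rightarrow> complex"
  assumes "arc c" "arc d" "pathstart d = pathstart c" "pathfinish d = pathfinish c"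
    and "path_image c \<inter> path_image d \<subseteq> {pathstart c, pathfinish c}"
  defines "J \<equiv> path_image c \<union> path_image d"
  shows "inside J \<noteq> {}" "open (inside J)" "connected (inside J)" "open (outside J)"
    "connected (outside J)" "inside J \<inter> outside J = {}" "inside J \<union> outside J = - J"
    "frontier (inside J) = J"
proof -
  have "simple_path (c +++ reversepath d)"
    using assms by (intro simple_path_join_loop) (auto simp: arc_reversepath)
  moreover have "path_image (c +++ reversepath d) = J"
    using assms by (simp add: path_image_join)
  moreover have "pathfinish (c +++ reversepath d) = pathstart (c +++ reversepath d)"
    using assms by simp
  ultimately show "inside J \<noteq> {}" "open (inside J)" "connected (inside J)" "open (outside J)"
    "connected (outside J)" "inside J \<inter> outside J = {}" "inside J \<union> outside J = - J"
    "frontier (inside J) = J"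
    using Jordan_inside_outside[of "c +++ reversepath d"] by auto
qed

lemma unbounded_connected_subset_outside:
  assumes "connected C" "\<not> bounded C" "C \<inter> S = {}"
  shows "C \<subseteq> outside S"
proof
  fix x assume "x \<in> C"
  then have "C \<subseteq> connected_component_set (- S) x"
    using assms by (intro connected_component_maximal) auto
  with \<open>\<not> bounded C\<close> have "\<not> bounded (connected_component_set (- S) x)"
    using bounded_subset by blast
  with \<open>x \<in> C\<close> assms(3) show "x \<in> outside S"
    by (auto simp: outside_def)
qed

lemma connected_inside_or_outside:
  fixes c d :: "real \<Rightarrow> complex"
  assumes "arc c" "arc d" "pathstart d = pathstart c" "pathfinish d = pathfinish c"
    and "path_image c \<inter> path_image d \<subseteq> {pathstart c, pathfinish c}"
    and "connected T" "T \<inter> (path_image c \<union> path_image d) = {}"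
  shows "T \<subseteq> inside (path_image c \<union> path_image d) \<or> T \<subseteq> outside (path_image c \<union> path_image d)"
proof -
  note J = Jordan_two_arcs[OF assms(1-5)]
  show ?thesis
    using connectedD[OF \<open>connected T\<close> J(2) J(4)] J(6,7) assms(7) by blast
qed

text \<open>The open arc is connected and misses the cycle, so it lies on one side. As
  \<open>C\<close> lies outside and the inside is open, the point \<open>v\<close> of the closure of
  \<open>C\<close> is not inside, which decides the side for the whole arc.\<close>

lemma accessible_arc_outside:
  fixes c d e :: "real \<Rightarrow> complex"
  assumes "arc c" "arc d" "pathstart d = pathstart c" "pathfinish d = pathfinish c"
    and "path_image c \<inter> path_image d \<subseteq> {pathstart c, pathfinish c}"
    and "arc e" "pathstart e = pathstart c" "pathfinish e = pathfinish c"
    and "path_image e \<inter> (path_image c \<union> path_image d) \<subseteq> {pathstart c, pathfinish c}"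
    and "connected C" "\<not> bounded C" "C \<inter> (path_image c \<union> path_image d) = {}"
    and "v \<in> path_image e" "v \<in> closure C" "v \<noteq> pathstart c" "v \<noteq> pathfinish c"
  shows "path_image e \<inter> inside (path_image c \<union> path_image d) = {}"
proof -
  let ?J = "path_image c \<union> path_image d" and ?T = "path_image e - {pathstart e, pathfinish e}"
  note J = Jordan_two_arcs[OF assms(1-5)]
  have "connected ?T"
    using \<open>arc e\<close> by (intro connected_simple_path_endless arc_imp_simple_path)
  moreover have "?T \<inter> ?J = {}"
    using assms by auto
  ultimately have "?T \<subseteq> inside ?J \<or> ?T \<subseteq> outside ?J"
    using connected_inside_or_outside[OF assms(1-5)] by blast
  moreover have "C \<subseteq> outside ?J"
    using assms by (intro unbounded_connected_subset_outside)
  then have "v \<notin> inside ?J"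
    using J(6) J(2) \<open>v \<in> closure C\<close> by (metis disjoint_iff in_mono open_Int_closure_eq_empty)
  moreover have "v \<in> ?T"
    using assms by auto
  ultimately have "?T \<subseteq> outside ?J" by blast
  moreover have "{pathstart e, pathfinish e} \<subseteq> ?J"
    using assms by (metis Un_iff empty_subsetI insert_subset pathfinish_in_path_image pathstart_in_path_image)
  ultimately show ?thesis
    using J(6,7) by blast
qed

text \<open>Each inside misses the other cycle, hence lies on one side of it. If the conclusion
  failed, the two insides would contain each other, and equal insides have equal frontiers, although
  the cycles differ.\<close>

lemma inside_subset_outside:
  fixes c d e :: "real \<Rightarrow> complex"
  assumes "arc c" "arc d" "pathstart d = pathstart c" "pathfinish d = pathfinish c"
    and "path_image c \<inter> path_image d \<subseteq> {pathstart c, pathfinish c}"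
    and "arc e" "pathstart e = pathstart c" "pathfinish e = pathfinish c"
    and "path_image c \<inter> path_image e \<subseteq> {pathstart c, pathfinish c}"
    and "path_image e \<inter> inside (path_image c \<union> path_image d) = {}"
    and "path_image d \<inter> inside (path_image c \<union> path_image e) = {}"
    and "path_image c \<union> path_image d \<noteq> path_image c \<union> path_image e"
  shows "inside (path_image c \<union> path_image d) \<subseteq> outside (path_image c \<union> path_image e)"
proof (rule ccontr)
  let ?J = "path_image c \<union> path_image d" and ?K = "path_image c \<union> path_image e"
  assume *: "\<not> inside ?J \<subseteq> outside ?K"
  note J = Jordan_two_arcs[OF assms(1-5)]
  note K = Jordan_two_arcs[OF assms(1,6-9)]
  have "inside ?J \<inter> ?K = {}" "inside ?K \<inter> ?J = {}"
    using J(6,7) K(6,7) assms(10,11) by blast+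
  then have JK: "inside ?J \<subseteq> inside ?K" and "inside ?K \<subseteq> inside ?J \<or> inside ?K \<subseteq> outside ?J"
    using connected_inside_or_outside[OF assms(1-5) K(3)]
      connected_inside_or_outside[OF assms(1,6-9) J(3)] * by blast+
  then have "inside ?J = inside ?K"
    using J(1,6) by blast
  then show False
    using J(8) K(8) assms(12) by metis
qed

text \<open>If one arc met the inside of the cycle formed by the other two, then \<open>C\<close>, lying outside this
  cycle, could not reach it. Hence the insides of the three cycles are disjoint from each other, and a
  point \<open>x\<close> inside \<open>c1 \<union> c2\<close> and a point \<open>y\<close> of \<open>C\<close> are both outside \<open>c1 \<union> c3\<close> and outside \<open>c2 \<union> c3\<close>.
  As these two cycles meet in the connected set \<open>c3\<close>, Janiszewski's theorem connects \<open>x\<close> to \<open>y\<close> off the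
  whole theta curve, which contradicts the Jordan curve theorem for \<open>c1 \<union> c2\<close>.\<close>

lemma theta_inaccessible:
  fixes c1 c2 c3 :: "real \<Rightarrow> complex"
  assumes "arc c1" "pathstart c1 = a" "pathfinish c1 = b"
    and "arc c2" "pathstart c2 = a" "pathfinish c2 = b"
    and "arc c3" "pathstart c3 = a" "pathfinish c3 = b"
    and "path_image c1 \<inter> path_image c2 \<subseteq> {a, b}"
    and "path_image c1 \<inter> path_image c3 \<subseteq> {a, b}"
    and "path_image c2 \<inter> path_image c3 \<subseteq> {a, b}"
    and "connected C" "\<not> bounded C"
    and "C \<inter> (path_image c1 \<union> path_image c2 \<union> path_image c3) = {}"
    and "v1 \<in> path_image c1 \<inter> closure C - {a, b}"
    and "v2 \<in> path_image c2 \<inter> closure C - {a, b}"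
    and "v3 \<in> path_image c3 \<inter> closure C - {a, b}"
  shows False
proof -
  let ?P1 = "path_image c1" and ?P2 = "path_image c2" and ?P3 = "path_image c3"
  have 1: "?P3 \<inter> inside (?P1 \<union> ?P2) = {}"
    by (rule accessible_arc_outside[where C = C and v = v3]) (use assms in auto)
  have 2: "?P2 \<inter> inside (?P1 \<union> ?P3) = {}"
    by (rule accessible_arc_outside[where C = C and v = v2]) (use assms in auto)
  have 3: "?P1 \<inter> inside (?P2 \<union> ?P3) = {}"
    by (rule accessible_arc_outside[where C = C and v = v1]) (use assms in auto)
  have i1: "inside (?P1 \<union> ?P2) \<subseteq> outside (?P1 \<union> ?P3)"
    by (rule inside_subset_outside) (use assms 1 2 in auto)
  have "inside (?P2 \<union> ?P1) \<subseteq> outside (?P2 \<union> ?P3)"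
    by (rule inside_subset_outside) (use assms 1 3 in \<open>simp_all add: Un_commute Int_commute\<close>, blast)
  then have i2: "inside (?P1 \<union> ?P2) \<subseteq> outside (?P2 \<union> ?P3)"
    by (simp add: Un_commute)
  note J12 = Jordan_two_arcs[of c1 c2] and J13 = Jordan_two_arcs[of c1 c3]
    and J23 = Jordan_two_arcs[of c2 c3]
  obtain x where x: "x \<in> inside (?P1 \<union> ?P2)"
    using J12(1) assms by auto
  obtain y where y: "y \<in> C"
    using \<open>\<not> bounded C\<close> by fastforce
  have out: "C \<subseteq> outside (?P1 \<union> ?P2)" "C \<subseteq> outside (?P1 \<union> ?P3)" "C \<subseteq> outside (?P2 \<union> ?P3)"
    by (rule unbounded_connected_subset_outside; use assms(13-15) in blast)+
  have cc: "connected_component (- S) x y"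
    if "connected (outside S)" "x \<in> outside S" "y \<in> outside S" for S
    unfolding connected_component_def using that outside_no_overlap[of S] by blast
  have "connected (outside (?P1 \<union> ?P3))" "connected (outside (?P2 \<union> ?P3))"
    using J13(5) J23(5) assms by auto
  then have "connected_component (- (?P1 \<union> ?P3)) x y" "connected_component (- (?P2 \<union> ?P3)) x y"
    using x y out i1 i2 by (blast intro: cc)+
  moreover have "(?P1 \<union> ?P3) \<inter> (?P2 \<union> ?P3) = ?P3"
    using assms(10) pathstart_in_path_image[of c3] pathfinish_in_path_image[of c3] assms(8,9) by blast
  then have "connected ((?P1 \<union> ?P3) \<inter> (?P2 \<union> ?P3))"
    using assms(7) by (simp add: connected_arc_image)
  moreover have "compact (?P1 \<union> ?P3)" "closed (?P2 \<union> ?P3)"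
    using assms by (auto simp: compact_Un compact_arc_image closed_arc_image closed_Un)
  ultimately have "connected_component (- ((?P1 \<union> ?P3) \<union> (?P2 \<union> ?P3))) x y"
    using Janiszewski[of "?P1 \<union> ?P3" "?P2 \<union> ?P3" x y] by blast
  then obtain T where T: "connected T" "T \<inter> (?P1 \<union> ?P2) = {}" "x \<in> T" "y \<in> T"
    unfolding connected_component_def by blast
  then have "T \<subseteq> inside (?P1 \<union> ?P2) \<or> T \<subseteq> outside (?P1 \<union> ?P2)"
    using assms by (intro connected_inside_or_outside) auto
  with T x y out(1) J12(6) assms show False
    by blast
qed

section \<open>Theta subdivisions in outer-planar graphs\<close>

lemma planar_embedding_inj: "planar_embedding V E f \<gamma> \<Longrightarrow> inj_on f V"
  by (simp add: planar_embedding_def)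

lemma planar_embedding_inter:
  "planar_embedding V E f \<gamma> \<Longrightarrow> e1 \<in> E \<Longrightarrow> e2 \<in> E \<Longrightarrow> e1 \<noteq> e2 \<Longrightarrow>
    path_image (\<gamma> e1) \<inter> path_image (\<gamma> e2) \<subseteq> f ` (e1 \<inter> e2)"
  by (simp add: planar_embedding_def)

lemma planar_embedding_edge:
  assumes "planar_embedding V E f \<gamma>" "e \<in> E"
  obtains u v where "e = {u, v}" "u \<noteq> v" "u \<in> V" "v \<in> V" "arc (\<gamma> e)"
    "{pathstart (\<gamma> e), pathfinish (\<gamma> e)} = {f u, f v}"
proof -
  have "\<forall>e\<in>E. \<exists>u v. e = {u, v} \<and> u \<noteq> v \<and> u \<in> V \<and> v \<in> V \<and>
        arc (\<gamma> e) \<and> {pathstart (\<gamma> e), pathfinish (\<gamma> e)} = {f u, f v}"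
    using assms(1) by (simp add: planar_embedding_def)
  then show thesis
    using assms(2) that by blast
qed

text \<open>The drawn edges of the path are joined one by one. Bounding the image by edges inside
  the vertex set of the path is what later keeps the arcs of disjoint paths apart.\<close>

lemma rtrancl_path_arc:
  assumes emb: "planar_embedding V E f \<gamma>"
    and "rtrancl_path (\<lambda>x y. {x, y} \<in> E) x xs y" "distinct (x # xs)" "xs \<noteq> []"
  shows "\<exists>g. arc g \<and> pathstart g = f x \<and> pathfinish g = f y \<and> f ` set (x # xs) \<subseteq> path_image g \<and>
           path_image g \<subseteq> (\<Union>e\<in>{e\<in>E. e \<subseteq> set (x # xs)}. path_image (\<gamma> e))"
  using assms(2-4)
proof induction
  case (base x)
  then show ?case by simp
next
  case (step x z xs y)
  obtain u v where uv: "{x, z} = {u, v}" "u \<noteq> v" "arc (\<gamma> {x, z})"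
      "{pathstart (\<gamma> {x, z}), pathfinish (\<gamma> {x, z})} = {f u, f v}"
    using planar_embedding_edge[OF emb \<open>{x, z} \<in> E\<close>] .
  moreover from uv(1) have "{f u, f v} = {f x, f z}"
    by (auto simp: doubleton_eq_iff)
  ultimately have "{pathstart (\<gamma> {x, z}), pathfinish (\<gamma> {x, z})} = {f x, f z}"
    by simp
  then have "(pathstart (\<gamma> {x, z}) = f x \<and> pathfinish (\<gamma> {x, z}) = f z) \<or>
      (pathstart (\<gamma> {x, z}) = f z \<and> pathfinish (\<gamma> {x, z}) = f x)"
    by (simp add: doubleton_eq_iff)
  \<comment> \<open>The embedding fixes no orientation of an edge, so the drawn arc may have to be
    reversed.\<close>
  then obtain h where h: "arc h" "pathstart h = f x" "pathfinish h = f z"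
      "path_image h = path_image (\<gamma> {x, z})"
    using that[of "\<gamma> {x, z}"] that[of "reversepath (\<gamma> {x, z})"] uv(3)
    by (auto simp: arc_reversepath)
  show ?case
  proof (cases "xs = []")
    case True
    with step.hyps have "z = y"
      by (auto elim: rtrancl_path.cases)
    have "{f x, f z} \<subseteq> path_image h"
      using h by (metis empty_subsetI insert_subset pathfinish_in_path_image pathstart_in_path_image)
    then show ?thesis
      using True h \<open>{x, z} \<in> E\<close> \<open>z = y\<close> by (intro exI[of _ h]) auto
  next
    case False
    then obtain g where g: "arc g" "pathstart g = f z" "pathfinish g = f y"
        "f ` set (z # xs) \<subseteq> path_image g"
        "path_image g \<subseteq> (\<Union>e\<in>{e\<in>E. e \<subseteq> set (z # xs)}. path_image (\<gamma> e))"
      using step by auto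
    have "path_image h \<inter> path_image g \<subseteq> {f z}"
    proof
      fix p assume "p \<in> path_image h \<inter> path_image g"
      then obtain e where e: "e \<in> E" "e \<subseteq> set (z # xs)" "p \<in> path_image (\<gamma> e)"
          "p \<in> path_image (\<gamma> {x, z})"
        using g(5) h(4) by blast
      \<comment> \<open>The edge \<open>e\<close> belongs to the rest of the path, where
        \<open>x\<close> does not recur; so it differs from \<open>{x, z}\<close> and can share only
        \<open>z\<close> with it.\<close>
      have "x \<notin> e"
        using e(2) step.prems by auto
      then have "p \<in> f ` ({x, z} \<inter> e)"
        using planar_embedding_inter[OF emb \<open>{x, z} \<in> E\<close> e(1)] e by blast
      with \<open>x \<notin> e\<close> show "p \<in> {f z}" by auto
    qed
    then have "arc (h +++ g)"
      using h g by (intro arc_join) auto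
    moreover have "path_image (h +++ g) = path_image (\<gamma> {x, z}) \<union> path_image g"
      using h g by (simp add: path_image_join)
    moreover have "f x \<in> path_image (\<gamma> {x, z})"
      using h by (metis pathstart_in_path_image)
    moreover have "path_image (\<gamma> {x, z}) \<union> path_image g
        \<subseteq> (\<Union>e\<in>{e\<in>E. e \<subseteq> set (x # z # xs)}. path_image (\<gamma> e))"
      using g(5) \<open>{x, z} \<in> E\<close> by fastforce
    ultimately show ?thesis
      using h g by (intro exI[of _ "h +++ g"]) (simp, blast)
  qed
qed

text \<open>Recording a vertex set in place of a path reduces internal disjointness of paths to
  intersections of sets.\<close>

abbreviation reachable_in :: "'v set set \<Rightarrow> 'v set \<Rightarrow> 'v \<Rightarrow> 'v \<Rightarrow> bool" where
  "reachable_in E S \<equiv> (\<lambda>x y. {x, y} \<in> E \<and> x \<in> S \<and> y \<in> S)\<^sup>*\<^sup>*"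

lemma reachable_in_mono: "reachable_in E S a b \<Longrightarrow> S \<subseteq> T \<Longrightarrow> reachable_in E T a b"
  by (erule rtranclp_mono[THEN predicate2D, rotated]) auto

lemma reachable_in_sym: "reachable_in E S a b \<Longrightarrow> reachable_in E S b a"
  by (rule sympD[OF symp_rtranclp]) (auto simp: symp_def insert_commute)

lemma reachable_in_step:
  "{a, b} \<in> E \<Longrightarrow> a \<in> S \<Longrightarrow> b \<in> S \<Longrightarrow> reachable_in E S b c \<Longrightarrow> reachable_in E S a c"
  by (rule converse_rtranclp_into_rtranclp) auto

lemma rtrancl_path_all_reached: "rtrancl_path r x xs y \<Longrightarrow> (\<And>u v. r u v \<Longrightarrow> P v) \<Longrightarrow> \<forall>v\<in>set xs. P v"
  by (induction rule: rtrancl_path.induct) auto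

text \<open>Since \<open>a\<close> and \<open>b\<close> are not adjacent, the vertex after
  \<open>a\<close> on a path to \<open>b\<close> differs from both. It serves as \<open>v\<close>,
  the vertex at which the outer face has to reach the arc.\<close>

lemma reachable_in_arc:
  assumes emb: "planar_embedding V E f \<gamma>"
    and "reachable_in E S a b" "a \<noteq> b" "{a, b} \<notin> E"
  obtains g v where "arc g" "pathstart g = f a" "pathfinish g = f b"
    "path_image g \<subseteq> (\<Union>e\<in>{e\<in>E. e \<subseteq> S}. path_image (\<gamma> e))"
    "v \<in> V" "f v \<in> path_image g - {f a, f b}"
proof -
  let ?r = "\<lambda>x y. {x, y} \<in> E \<and> x \<in> S \<and> y \<in> S"
  have VE: "x \<in> V \<and> y \<in> V \<and> x \<noteq> y" if "{x, y} \<in> E" for x y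
    using planar_embedding_edge[OF emb that] by (auto simp: doubleton_eq_iff)
  obtain xs where xs: "rtrancl_path ?r a xs b" "distinct (a # xs)"
    using assms(2) rtrancl_path_distinct[of ?r a _ b] unfolding rtranclp_eq_rtrancl_path by blast
  obtain v ys where v: "xs = v # ys" "?r a v" "rtrancl_path ?r v ys b"
    using xs(1) \<open>a \<noteq> b\<close> by (auto elim: rtrancl_path.cases)
  have sub: "set (a # xs) \<subseteq> S"
    using rtrancl_path_all_reached[OF xs(1), of "\<lambda>v. v \<in> S"] v by auto
  have "rtrancl_path (\<lambda>x y. {x, y} \<in> E) a xs b"
    using xs(1) by (rule rtrancl_path_mono) auto
  then obtain g where g: "arc g" "pathstart g = f a" "pathfinish g = f b"
      "f ` set (a # xs) \<subseteq> path_image g"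
      "path_image g \<subseteq> (\<Union>e\<in>{e\<in>E. e \<subseteq> set (a # xs)}. path_image (\<gamma> e))"
    using rtrancl_path_arc[OF emb _ xs(2)] v(1) by blast
  have "{a, v} \<in> E" using v by simp
  have "b \<in> V"
    using assms(2,3) by (induction rule: rtranclp.induct) (use VE in auto)
  moreover have "v \<noteq> b"
    using v(2) assms(4) by auto
  moreover have "inj_on f V"
    using emb by (rule planar_embedding_inj)
  ultimately have "f v \<notin> {f a, f b}"
    using VE[OF \<open>{a, v} \<in> E\<close>] by (auto dest: inj_onD)
  moreover have "f v \<in> path_image g"
    using g(4) v(1) by auto
  moreover have "path_image g \<subseteq> (\<Union>e\<in>{e\<in>E. e \<subseteq> S}. path_image (\<gamma> e))"
    using g(5) sub by fastforce
  ultimately show thesis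
    using that g VE[OF \<open>{a, v} \<in> E\<close>] by blast
qed

text \<open>The three paths are drawn as a theta curve. Each of its arcs carries an interior vertex,
  which lies on the frontier of the unbounded face \<open>C\<close>; this is the situation excluded
  by \<open>theta_inaccessible\<close>.\<close>

theorem not_outer_planar_if_theta:
  assumes "a \<noteq> b" "{a, b} \<notin> E"
    and "reachable_in E S1 a b" "reachable_in E S2 a b" "reachable_in E S3 a b"
    and "S1 \<inter> S2 \<subseteq> {a, b}" "S1 \<inter> S3 \<subseteq> {a, b}" "S2 \<inter> S3 \<subseteq> {a, b}"
  shows "\<not> outer_planar V E"
proof
  assume "outer_planar V E"
  then obtain f \<gamma> x where emb: "planar_embedding V E f \<gamma>"
    and unb: "\<not> bounded (connected_component_set (- drawing V E f \<gamma>) x)"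
    and fr: "\<forall>v\<in>V. f v \<in> frontier (connected_component_set (- drawing V E f \<gamma>) x)"
    unfolding outer_planar_def by blast
  define C where "C = connected_component_set (- drawing V E f \<gamma>) x"
  let ?D = "\<lambda>S. \<Union>e\<in>{e\<in>E. e \<subseteq> S}. path_image (\<gamma> e)"
  obtain g1 v1 where g1: "arc g1" "pathstart g1 = f a" "pathfinish g1 = f b"
      "path_image g1 \<subseteq> ?D S1" "v1 \<in> V" "f v1 \<in> path_image g1 - {f a, f b}"
    using reachable_in_arc[OF emb assms(3,1,2)] .
  obtain g2 v2 where g2: "arc g2" "pathstart g2 = f a" "pathfinish g2 = f b"
      "path_image g2 \<subseteq> ?D S2" "v2 \<in> V" "f v2 \<in> path_image g2 - {f a, f b}"
    using reachable_in_arc[OF emb assms(4,1,2)] .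
  obtain g3 v3 where g3: "arc g3" "pathstart g3 = f a" "pathfinish g3 = f b"
      "path_image g3 \<subseteq> ?D S3" "v3 \<in> V" "f v3 \<in> path_image g3 - {f a, f b}"
    using reachable_in_arc[OF emb assms(5,1,2)] .
  have D: "?D S \<inter> ?D T \<subseteq> {f a, f b}" if ST: "S \<inter> T \<subseteq> {a, b}" for S T
  proof
    fix p assume "p \<in> ?D S \<inter> ?D T"
    then obtain e1 e2 where e: "e1 \<in> E" "e2 \<in> E" "e1 \<subseteq> S" "e2 \<subseteq> T"
        "p \<in> path_image (\<gamma> e1)" "p \<in> path_image (\<gamma> e2)"
      by blast
    \<comment> \<open>A common edge would join \<open>a\<close> and \<open>b\<close>, which are not
      adjacent.\<close>
    have "e1 \<noteq> e2"
    proof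
      assume "e1 = e2"
      then have "e1 \<subseteq> {a, b}" using e ST by blast
      moreover obtain u v where "e1 = {u, v}" "u \<noteq> v"
        using planar_embedding_edge[OF emb e(1)] by metis
      ultimately have "e1 = {a, b}" by auto
      then show False using e(1) assms(2) by simp
    qed
    then have "p \<in> f ` (e1 \<inter> e2)"
      using planar_embedding_inter[OF emb e(1,2)] e(5,6) by blast
    then show "p \<in> {f a, f b}" using e ST by blast
  qed
  have cl: "f v \<in> closure C" if "v \<in> V" for v
    using fr that by (auto simp: frontier_def C_def)
  have CD: "C \<inter> drawing V E f \<gamma> = {}"
    using connected_component_subset[of "- drawing V E f \<gamma>" x] by (auto simp: C_def)
  have D_drawing: "?D S \<subseteq> drawing V E f \<gamma>" for S
    unfolding drawing_def by blast
  have "C \<inter> P = {}" if "P \<subseteq> ?D S" for P S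
    using CD subset_trans[OF that D_drawing] by blast
  from this[OF g1(4)] this[OF g2(4)] this[OF g3(4)]
  have "C \<inter> (path_image g1 \<union> path_image g2 \<union> path_image g3) = {}"
    by (simp add: Int_Un_distrib)
  moreover have "path_image g1 \<inter> path_image g2 \<subseteq> {f a, f b}"
    by (rule order_trans[OF Int_mono[OF g1(4) g2(4)] D[OF assms(6)]])
  moreover have "path_image g1 \<inter> path_image g3 \<subseteq> {f a, f b}"
    by (rule order_trans[OF Int_mono[OF g1(4) g3(4)] D[OF assms(7)]])
  moreover have "path_image g2 \<inter> path_image g3 \<subseteq> {f a, f b}"
    by (rule order_trans[OF Int_mono[OF g2(4) g3(4)] D[OF assms(8)]])
  ultimately show False
    using theta_inaccessible[of g1 "f a" "f b" g2 g3 C "f v1" "f v2" "f v3"]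
      g1 g2 g3 cl unb by (simp add: C_def)
qed

section \<open>Maximal subgroups\<close>

lemma subgroup_graph_edges_iff:
  "{H, K} \<in> subgroup_graph_edges G \<longleftrightarrow> maximal_subgroup_of G H K \<or> maximal_subgroup_of G K H"
  unfolding subgroup_graph_edges_def by (auto simp: doubleton_eq_iff)

lemma maximal_subgroup_of_between:
  "maximal_subgroup_of G H K \<Longrightarrow> subgroup L G \<Longrightarrow> H \<subseteq> L \<Longrightarrow> L \<subseteq> K \<Longrightarrow> L = H \<or> L = K"
  unfolding maximal_subgroup_of_def by blast

lemma not_edge_if_between:
  assumes "subgroup L G" "H \<subset> L" "L \<subset> K"
  shows "{H, K} \<notin> subgroup_graph_edges G"
  using assms unfolding subgroup_graph_edges_iff maximal_subgroup_of_def by blast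

lemma maximal_subgroup_of_antichain:
  assumes "maximal_subgroup_of G M K" "maximal_subgroup_of G N K" "M \<noteq> N"
  shows "\<not> M \<subseteq> N"
  using assms unfolding maximal_subgroup_of_def by blast

lemma exists_maximal_subgroup_above:
  assumes "subgroup A G" "subgroup B G" "A \<subset> B" "finite B"
  obtains M where "maximal_subgroup_of G M B" "A \<subseteq> M"
proof -
  let ?S = "{Z. subgroup Z G \<and> Z \<subset> B}"
  have "finite ?S"
    by (rule finite_subset[OF _ finite_Pow_iff[THEN iffD2, OF \<open>finite B\<close>]]) auto
  then obtain M where "M \<in> ?S" "A \<subseteq> M" "\<forall>Z\<in>?S. M \<subseteq> Z \<longrightarrow> M = Z"
    using finite_has_maximal2[of ?S A] assms by auto
  then have "maximal_subgroup_of G M B"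
    using assms unfolding maximal_subgroup_of_def by blast
  with \<open>A \<subseteq> M\<close> show thesis using that by blast
qed

text \<open>Descending from \<open>B\<close> to a maximal subgroup that still contains
  \<open>A\<close> is one edge inside the interval, and finiteness of \<open>B\<close> lets this
  end.\<close>

lemma interval_reachable:
  assumes "subgroup A G" "subgroup B G" "A \<subseteq> B" "finite B"
  shows "reachable_in (subgroup_graph_edges G) {A..B} A B"
  using assms(4,2,3)
proof (induction B rule: finite_psubset_induct)
  case (psubset B)
  show ?case
  proof (cases "A = B")
    case False
    then obtain M where M: "maximal_subgroup_of G M B" "A \<subseteq> M"
      using exists_maximal_subgroup_above[of A G B] psubset assms(1) by blast
    then have "M \<subset> B" "subgroup M G"
      unfolding maximal_subgroup_of_def by auto
    then have "reachable_in (subgroup_graph_edges G) {A..B} A M"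
      using reachable_in_mono[OF psubset.IH[of M], of "{A..B}"] M by auto
    then show ?thesis
      using M \<open>M \<subset> B\<close> by (elim rtranclp.rtrancl_into_rtrancl) (auto simp: subgroup_graph_edges_iff)
  qed simp
qed

text \<open>Finiteness is asked of \<open>M\<close> and not of \<open>K\<close>: such paths are
  needed before \<open>K\<close> is known to be finite.\<close>

lemma interval_reachable_top:
  assumes "subgroup A G" "maximal_subgroup_of G M K" "A \<subseteq> M" "finite M"
  shows "reachable_in (subgroup_graph_edges G) (insert K {A..M}) A K"
proof -
  have "subgroup M G"
    using assms(2) by (simp add: maximal_subgroup_of_def)
  then have "reachable_in (subgroup_graph_edges G) (insert K {A..M}) A M"
    using reachable_in_mono[OF interval_reachable[OF assms(1) _ assms(3,4)], of "insert K {A..M}"]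
    by blast
  then show ?thesis
    using assms by (elim rtranclp.rtrancl_into_rtrancl) (auto simp: subgroup_graph_edges_iff)
qed

lemma interval_Int:
  fixes A M N K :: "'a set"
  assumes "M \<inter> N \<subseteq> A"
  shows "insert K {A..M} \<inter> insert K {A..N} \<subseteq> {A, K}"
proof
  fix Z assume "Z \<in> insert K {A..M} \<inter> insert K {A..N}"
  then have "Z = K \<or> A \<subseteq> Z \<and> Z \<subseteq> M \<inter> N" by auto
  with assms show "Z \<in> {A, K}" by blast
qed

text \<open>The second set belongs to a path that descends from \<open>A\<close> to \<open>D\<close>
  and climbs again through \<open>N\<close>. A member of it that contains \<open>A\<close> is
  \<open>A\<close> or \<open>K\<close>, or else forces \<open>A\<close> into
  \<open>N\<close>.\<close>

lemma interval_Int_Un: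
  fixes A D M N K :: "'a set"
  assumes "\<not> A \<subseteq> N"
  shows "insert K {A..M} \<inter> ({D..A} \<union> insert K {D..N}) \<subseteq> {A, K}"
proof
  fix Z assume "Z \<in> insert K {A..M} \<inter> ({D..A} \<union> insert K {D..N})"
  then have "Z = K \<or> A \<subseteq> Z \<and> (Z \<subseteq> A \<or> Z \<subseteq> N)" by auto
  with assms show "Z \<in> {A, K}" by blast
qed

context group
begin

text \<open>Otherwise \<open>M1 \<inter> M2\<close> and \<open>K\<close> are joined by a path through \<open>M1\<close>, one through \<open>M2\<close>, and one that
  descends to \<open>M1 \<inter> M2 \<inter> M3\<close> and then ascends through \<open>M3\<close>.\<close>

lemma maximal_subgroups_Int_subset:
  assumes "outer_planar V (subgroup_graph_edges G)"
    and "maximal_subgroup_of G M1 K" "maximal_subgroup_of G M2 K" "maximal_subgroup_of G M3 K"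
    and "M1 \<noteq> M2" "finite M1" "finite M2" "finite M3"
  shows "M1 \<inter> M2 \<subseteq> M3"
proof (rule ccontr)
  assume *: "\<not> M1 \<inter> M2 \<subseteq> M3"
  let ?E = "subgroup_graph_edges G" and ?B = "M1 \<inter> M2" and ?D = "M1 \<inter> M2 \<inter> M3"
  have M: "subgroup M1 G" "subgroup M2 G" "subgroup M3 G" "M1 \<subset> K" "M2 \<subset> K" "M3 \<subset> K"
    using assms(2-4) by (auto simp: maximal_subgroup_of_def)
  then have sub: "subgroup ?B G" "subgroup ?D G"
    by (auto intro: subgroups_Inter_pair)
  have "?B \<subset> M1"
    using maximal_subgroup_of_antichain[OF assms(2,3,5)] by blast
  have "?B \<noteq> K" using M by auto
  moreover have "{?B, K} \<notin> ?E"
    using M \<open>?B \<subset> M1\<close>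
    by (intro not_edge_if_between[of M1]) auto
  moreover have "reachable_in ?E (insert K {?B..M1}) ?B K"
    using assms sub by (intro interval_reachable_top) auto
  moreover have "reachable_in ?E (insert K {?B..M2}) ?B K"
    using assms sub by (intro interval_reachable_top) auto
  moreover have "reachable_in ?E ({?D..?B} \<union> insert K {?D..M3}) ?B K"
  proof (rule rtranclp_trans)
    have r1: "reachable_in ?E {?D..?B} ?D ?B"
      using assms sub by (intro interval_reachable) auto
    show "reachable_in ?E ({?D..?B} \<union> insert K {?D..M3}) ?B ?D"
      by (rule reachable_in_mono[OF reachable_in_sym[OF r1]]) blast
    have r2: "reachable_in ?E (insert K {?D..M3}) ?D K"
      using assms sub by (intro interval_reachable_top) auto
    show "reachable_in ?E ({?D..?B} \<union> insert K {?D..M3}) ?D K"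
      by (rule reachable_in_mono[OF r2]) blast
  qed
  moreover have "insert K {?B..M1} \<inter> insert K {?B..M2} \<subseteq> {?B, K}"
    by (rule interval_Int) simp
  moreover have "insert K {?B..M1} \<inter> ({?D..?B} \<union> insert K {?D..M3}) \<subseteq> {?B, K}"
    using * by (rule interval_Int_Un)
  moreover have "insert K {?B..M2} \<inter> ({?D..?B} \<union> insert K {?D..M3}) \<subseteq> {?B, K}"
    using * by (rule interval_Int_Un)
  ultimately have "\<not> outer_planar V ?E"
    by (rule not_outer_planar_if_theta)
  with assms(1) show False by contradiction
qed

text \<open>By \<open>maximal_subgroups_Int_subset\<close> the three pairwise intersections
  coincide. From this common subgroup to \<open>K\<close>, the paths through the three maximal
  subgroups are internally disjoint and form a theta.\<close>

lemma no_three_maximal_subgroups: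
  assumes op: "outer_planar V (subgroup_graph_edges G)"
    and "maximal_subgroup_of G M1 K" "maximal_subgroup_of G M2 K" "maximal_subgroup_of G M3 K"
    and "finite M1" "finite M2" "finite M3"
    and "M1 \<noteq> M2" "M1 \<noteq> M3" "M2 \<noteq> M3"
  shows False
proof -
  let ?E = "subgroup_graph_edges G" and ?D = "M1 \<inter> M2"
  have M: "subgroup M1 G" "subgroup M2 G" "subgroup M3 G" "M1 \<subset> K" "M2 \<subset> K" "M3 \<subset> K"
    using assms(2-4) by (auto simp: maximal_subgroup_of_def)
  then have sub: "subgroup ?D G"
    by (auto intro: subgroups_Inter_pair)
  have "M1 \<inter> M2 \<subseteq> M3" "M1 \<inter> M3 \<subseteq> M2" "M2 \<inter> M3 \<subseteq> M1"
    using maximal_subgroups_Int_subset[OF op] assms by auto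
  then have D: "?D \<subseteq> M3" "M1 \<inter> M3 = ?D" "M2 \<inter> M3 = ?D"
    by auto
  have "?D \<subset> M1"
    using maximal_subgroup_of_antichain[OF assms(2,3)] assms by blast
  have "?D \<noteq> K" using M by auto
  moreover have "{?D, K} \<notin> ?E"
    using M \<open>?D \<subset> M1\<close>
    by (intro not_edge_if_between[of M1]) auto
  moreover have "reachable_in ?E (insert K {?D..M1}) ?D K"
    using assms sub by (intro interval_reachable_top) auto
  moreover have "reachable_in ?E (insert K {?D..M2}) ?D K"
    using assms sub by (intro interval_reachable_top) auto
  moreover have "reachable_in ?E (insert K {?D..M3}) ?D K"
    using assms sub D by (intro interval_reachable_top) auto
  moreover have "insert K {?D..M1} \<inter> insert K {?D..M2} \<subseteq> {?D, K}"
    by (rule interval_Int) simp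
  moreover have "insert K {?D..M1} \<inter> insert K {?D..M3} \<subseteq> {?D, K}"
    by (rule interval_Int) (simp add: D)
  moreover have "insert K {?D..M2} \<inter> insert K {?D..M3} \<subseteq> {?D, K}"
    by (rule interval_Int) (simp add: D)
  ultimately have "\<not> outer_planar V ?E"
    by (rule not_outer_planar_if_theta)
  with assms(1) show False by contradiction
qed

section \<open>Conjugates and finiteness of overgroups\<close>

abbreviation conj_set :: "'a \<Rightarrow> 'a set \<Rightarrow> 'a set" where
  "conj_set x H \<equiv> (\<lambda>h. x \<otimes> h \<otimes> inv x) ` H"

lemma conj_set_mult:
  assumes "x \<in> carrier G" "y \<in> carrier G" "H \<subseteq> carrier G"
  shows "conj_set (x \<otimes> y) H = conj_set x (conj_set y H)"
proof -
  have "x \<otimes> y \<otimes> h \<otimes> inv (x \<otimes> y) = x \<otimes> (y \<otimes> h \<otimes> inv y) \<otimes> inv x" if "h \<in> H" for h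
    using that assms by (simp add: m_assoc inv_mult_group subsetD)
  then show ?thesis
    by (simp add: image_image cong: image_cong_simp)
qed

lemma conj_set_one: "H \<subseteq> carrier G \<Longrightarrow> conj_set \<one> H = H"
  by (simp add: subset_iff cong: image_cong_simp)

lemma conj_set_inv:
  assumes "x \<in> carrier G" "H \<subseteq> carrier G"
  shows "conj_set (inv x) (conj_set x H) = H" "conj_set x (conj_set (inv x) H) = H"
proof -
  show "conj_set (inv x) (conj_set x H) = H"
    using conj_set_mult[of "inv x" x H, symmetric] conj_set_one[of H] assms by (simp only: l_inv inv_closed)
  show "conj_set x (conj_set (inv x) H) = H"
    using conj_set_mult[of x "inv x" H, symmetric] conj_set_one[of H] assms by (simp only: r_inv inv_closed)
qed

lemma conj_set_subgroup:
  assumes "x \<in> carrier G" "subgroup H G"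
  shows "subgroup (conj_set x H) G"
proof -
  have "(\<lambda>h. x \<otimes> h \<otimes> inv x) \<in> hom G G"
    using assms(1) by (auto intro!: homI simp: m_assoc inv_solve_left)
  then interpret group_hom G G "\<lambda>h. x \<otimes> h \<otimes> inv x"
    by unfold_locales
  show ?thesis
    using subgroup_img_is_subgroup[OF assms(2)] .
qed

lemma conj_set_self:
  assumes "subgroup K G" "x \<in> K"
  shows "conj_set x K = K"
proof -
  interpret K: subgroup K G by fact
  have *: "conj_set y K \<subseteq> K" if "y \<in> K" for y
    using that by auto
  have "K = conj_set x (conj_set (inv x) K)"
    using assms conj_set_inv(2)[of x K] K.subset by auto
  also have "\<dots> \<subseteq> conj_set x K"
    using *[of "inv x"] assms by (intro image_mono) auto
  finally show ?thesis
    using *[OF assms(2)] by blast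
qed

lemma conj_set_psubset:
  assumes "x \<in> carrier G" "A \<subset> B" "B \<subseteq> carrier G"
  shows "conj_set x A \<subset> conj_set x B"
proof (rule image_strict_mono[OF _ assms(2)])
  show "inj_on (\<lambda>h. x \<otimes> h \<otimes> inv x) B"
    using assms by (intro inj_onI) (simp add: subset_iff)
qed

text \<open>Conjugation by \<open>inv x\<close> carries a subgroup strictly between the conjugate
  and \<open>K\<close> to one strictly between \<open>H\<close> and \<open>K\<close>.\<close>

lemma conj_set_maximal:
  assumes "maximal_subgroup_of G H K" "x \<in> K"
  shows "maximal_subgroup_of G (conj_set x H) K"
proof -
  have HK: "subgroup H G" "subgroup K G" "H \<subset> K"
    using assms(1) by (auto simp: maximal_subgroup_of_def)
  then have sub: "H \<subseteq> carrier G" "K \<subseteq> carrier G" and x: "x \<in> carrier G" "inv x \<in> K"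
    using assms(2) by (auto dest: subgroup.subset subgroup.m_inv_closed)
  have "\<not> (conj_set x H \<subset> L \<and> L \<subset> K)" if L: "subgroup L G" for L
  proof
    assume *: "conj_set x H \<subset> L \<and> L \<subset> K"
    have "H = conj_set (inv x) (conj_set x H)"
      using conj_set_inv(1)[of x H] sub x by simp
    also have "\<dots> \<subset> conj_set (inv x) L"
      using * L x by (intro conj_set_psubset) (auto dest: subgroup.subset)
    finally have "H \<subset> conj_set (inv x) L" .
    moreover have "conj_set (inv x) L \<subset> conj_set (inv x) K"
      using * x sub by (intro conj_set_psubset) auto
    then have "conj_set (inv x) L \<subset> K"
      using conj_set_self[OF HK(2) x(2)] by simp
    ultimately show False
      using assms(1) conj_set_subgroup[OF _ L, of "inv x"] x(1)
      unfolding maximal_subgroup_of_def by auto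
  qed
  moreover have "conj_set x H \<subset> K"
    using conj_set_psubset[OF x(1) HK(3)] sub conj_set_self[OF HK(2) assms(2)] by simp
  ultimately show ?thesis
    using HK conj_set_subgroup[OF x(1)] unfolding maximal_subgroup_of_def by blast
qed

text \<open>When \<open>H\<close> is maximal in \<open>K\<close>, this normalizer lies between them
  and so equals one of them.\<close>

lemma normalizer_in_subgroup:
  assumes "subgroup H G" "subgroup K G"
  shows "subgroup {x\<in>K. conj_set x H = H} G"
proof (rule subgroupI)
  have sub: "H \<subseteq> carrier G" "K \<subseteq> carrier G"
    using assms by (auto dest: subgroup.subset)
  show "{x\<in>K. conj_set x H = H} \<subseteq> carrier G"
    using sub by auto
  have "\<one> \<in> {x\<in>K. conj_set x H = H}"
    using conj_set_one[OF sub(1)] subgroup.one_closed[OF assms(2)] by blast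
  then show "{x\<in>K. conj_set x H = H} \<noteq> {}" by blast
  fix x assume x: "x \<in> {x\<in>K. conj_set x H = H}"
  then have "x \<in> carrier G" "conj_set x H = H" using sub by auto
  then have "conj_set (inv x) H = H"
    using conj_set_inv(1)[of x H] sub by simp
  then show "inv x \<in> {x\<in>K. conj_set x H = H}"
    using x subgroup.m_inv_closed[OF assms(2)] by blast
  fix y assume y: "y \<in> {x\<in>K. conj_set x H = H}"
  then have "y \<in> carrier G" "conj_set y H = H" using sub by auto
  then have "conj_set (x \<otimes> y) H = H"
    using conj_set_mult[of x y H] \<open>x \<in> carrier G\<close> \<open>conj_set x H = H\<close> sub by simp
  then show "x \<otimes> y \<in> {x\<in>K. conj_set x H = H}"
    using x y subgroup.m_closed[OF assms(2)] by blast
qed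

text \<open>Powers of \<open>x\<close> normalize \<open>H\<close>, so they can be moved past an
  element of \<open>H\<close> at the cost of replacing that element by another one. Products and
  inverses thus regain the shape \<open>h \<otimes> x [^] i\<close>.\<close>

lemma subgroup_mult_powers:
  assumes "subgroup H G" "x \<in> carrier G" "\<And>i::int. conj_set (x [^] i) H = H"
  shows "subgroup {h \<otimes> x [^] (i::int) | h i. h \<in> H} G"
proof (rule subgroupI)
  interpret H: subgroup H G by fact
  let ?P = "{h \<otimes> x [^] (i::int) | h i. h \<in> H}"
  show "?P \<subseteq> carrier G"
    using assms(2) by auto
  show "?P \<noteq> {}"
    using H.one_closed by blast
  have comm: "\<exists>k\<in>H. x [^] i \<otimes> h = k \<otimes> x [^] i" if "h \<in> H" for h and i :: int
  proof
    show "x [^] i \<otimes> h \<otimes> inv (x [^] i) \<in> H"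
      using assms(3)[of i] that by blast
    show "x [^] i \<otimes> h = x [^] i \<otimes> h \<otimes> inv (x [^] i) \<otimes> x [^] i"
      using that assms(2) by (simp add: m_assoc)
  qed
  fix a assume "a \<in> ?P"
  then obtain h i where a: "a = h \<otimes> x [^] (i::int)" "h \<in> H" by blast
  obtain k where k: "k \<in> H" "x [^] (- i) \<otimes> inv h = k \<otimes> x [^] (- i)"
    using comm[of "inv h" "- i"] a by auto
  have "inv a = k \<otimes> x [^] (- i)"
    using a assms(2) k(2) by (simp add: inv_mult_group int_pow_neg)
  then show "inv a \<in> ?P"
    using k by blast
  fix b assume "b \<in> ?P"
  then obtain h' j where b: "b = h' \<otimes> x [^] (j::int)" "h' \<in> H" by blast
  obtain l where l: "l \<in> H" "x [^] i \<otimes> h' = l \<otimes> x [^] i"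
    using comm[of h' i] b by auto
  have "a \<otimes> b = h \<otimes> (x [^] i \<otimes> h') \<otimes> x [^] j"
    using a b assms(2) by (simp add: m_assoc)
  also have "\<dots> = (h \<otimes> l) \<otimes> x [^] (i + j)"
    using a b l assms(2) by (simp add: m_assoc int_pow_mult)
  finally show "a \<otimes> b \<in> ?P"
    using a l by blast
qed

text \<open>In effect, the quotient of \<open>K\<close> by \<open>H\<close> has no proper nontrivial
  subgroup and is therefore finite cyclic. Without forming it: \<open>K\<close> is the product of
  \<open>H\<close> with the powers of any element outside \<open>H\<close>, and some nonzero power
  of that element lies in \<open>H\<close>.\<close>

lemma normal_maximal_finite:
  assumes max: "maximal_subgroup_of G H K" and "finite H" "\<And>y. y \<in> K \<Longrightarrow> conj_set y H = H"
  shows "finite K"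
proof -
  have HK: "subgroup H G" "subgroup K G" "H \<subset> K"
    using max by (auto simp: maximal_subgroup_of_def)
  interpret H: subgroup H G by fact
  interpret K: subgroup K G by fact
  let ?P = "\<lambda>x. {h \<otimes> x [^] (i::int) | h i. h \<in> H}"
  have pow: "y [^] (i::int) \<in> K" if "y \<in> K" for y i
    using that HK(2) subgroup_int_pow_closed by blast
  have P: "?P y = K" if "y \<in> K" "y \<notin> H" for y
  proof -
    have y: "y \<in> carrier G" using that by simp
    have HP: "H \<subseteq> ?P y"
    proof
      fix h assume "h \<in> H"
      then have "h = h \<otimes> y [^] (0::int)" by simp
      with \<open>h \<in> H\<close> show "h \<in> ?P y" by blast
    qed
    have "y = \<one> \<otimes> y [^] (1::int)"
      using y by simp
    then have "y \<in> ?P y"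
      using H.one_closed by blast
    then have "?P y \<noteq> H"
      using that(2) by metis
    have "h \<otimes> y [^] i \<in> K" if "h \<in> H" for h and i :: int
      using HK(3) pow[OF \<open>y \<in> K\<close>] that by blast
    then have PK: "?P y \<subseteq> K"
      by blast
    have "subgroup (?P y) G"
      using assms(3)[OF pow[OF that(1)]] by (intro subgroup_mult_powers HK y)
    from maximal_subgroup_of_between[OF max this HP PK] \<open>?P y \<noteq> H\<close>
    show ?thesis by blast
  qed
  obtain x where x: "x \<in> K" "x \<notin> H" using HK(3) by blast
  then have xG: "x \<in> carrier G" by simp
  \<comment> \<open>Unless the square of \<open>x\<close> is in \<open>H\<close>, its powers
    together with \<open>H\<close> give all of \<open>K\<close>, in particular \<open>x\<close>
    itself. Comparing exponents puts \<open>x [^] (1 - 2 * i)\<close> into \<open>H\<close>, and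
    this exponent is odd, hence nonzero.\<close>
  obtain n :: int where n: "n \<noteq> 0" "x [^] n \<in> H"
  proof (cases "x [^] (2::int) \<in> H")
    case True
    then show thesis using that[of 2] by simp
  next
    case False
    then obtain h i where hi: "x = h \<otimes> (x [^] (2::int)) [^] (i::int)" "h \<in> H"
      using P[OF pow[OF x(1)] False] x(1) by blast
    then have "x [^] (1::int) = h \<otimes> x [^] (2 * i)"
      using xG by (simp add: int_pow_pow)
    then have "h = x [^] (1::int) \<otimes> inv (x [^] (2 * i))"
      using xG hi(2) by (intro inv_solve_right[THEN iffD2]) auto
    then have "x [^] (1 - 2 * i) = h"
      using xG by (simp only: int_pow_diff)
    moreover have "1 - 2 * i \<noteq> 0" by presburger
    ultimately show thesis using that hi(2) by metis
  qed
  \<comment> \<open>As \<open>n\<close> may be negative, exponents are reduced modulo its absolute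
    value; the multiple of \<open>n\<close> is absorbed into \<open>H\<close>.\<close>
  have "K \<subseteq> (\<lambda>(h, i). h \<otimes> x [^] i) ` (H \<times> {0..<\<bar>n\<bar>})"
  proof
    fix a assume "a \<in> K"
    then obtain h i where a: "a = h \<otimes> x [^] (i::int)" "h \<in> H"
      using P[OF x] by blast
    have r: "i mod \<bar>n\<bar> \<in> {0..<\<bar>n\<bar>}" using n(1) by simp
    obtain q where q: "i = n * q + i mod \<bar>n\<bar>"
      by (metis abs_dvd_iff dvd_def dvd_minus_mod add_diff_cancel_left' diff_add_cancel)
    have "x [^] i = (x [^] n) [^] q \<otimes> x [^] (i mod \<bar>n\<bar>)"
      using xG by (subst q) (simp add: int_pow_mult int_pow_pow)
    then have "a = (h \<otimes> (x [^] n) [^] q) \<otimes> x [^] (i mod \<bar>n\<bar>)"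
      using a xG by (simp add: m_assoc)
    moreover have "h \<otimes> (x [^] n) [^] q \<in> H"
      using a n(2) HK(1) subgroup_int_pow_closed by blast
    ultimately show "a \<in> (\<lambda>(h, i). h \<otimes> x [^] i) ` (H \<times> {0..<\<bar>n\<bar>})"
      using r by force
  qed
  then show ?thesis
    by (rule finite_subset) (simp add: \<open>finite H\<close>)
qed

text \<open>If \<open>H\<close> is not normal in \<open>K\<close>, it is its own normalizer there, so its conjugates correspond to
  the cosets of \<open>H\<close>; all of them are finite maximal subgroups of \<open>K\<close>, hence there are at most two.\<close>

lemma finite_if_maximal_finite:
  assumes op: "outer_planar V (subgroup_graph_edges G)"
    and max: "maximal_subgroup_of G H K" and "finite H"
  shows "finite K"
proof (rule ccontr)
  assume inf: "infinite K"
  have HK: "subgroup H G" "subgroup K G" "H \<subset> K"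
    using max by (auto simp: maximal_subgroup_of_def)
  interpret K: subgroup K G by fact
  let ?N = "{x\<in>K. conj_set x H = H}"
  have "H \<subseteq> ?N"
    using conj_set_self[OF HK(1)] HK(3) by auto
  then have "?N = H \<or> ?N = K"
    by (intro maximal_subgroup_of_between[OF max] normalizer_in_subgroup HK) auto
  moreover have "?N \<noteq> K"
    using normal_maximal_finite[OF max \<open>finite H\<close>] inf by blast
  ultimately have N: "?N = H" by blast
  have "finite ((\<lambda>x. conj_set x H) ` K)"
  proof (rule ccontr)
    assume "infinite ((\<lambda>x. conj_set x H) ` K)"
    then obtain T where T: "T \<subseteq> (\<lambda>x. conj_set x H) ` K" "card T = 3"
      using infinite_arbitrarily_large by blast
    then obtain A B C where ABC: "T = {A, B, C}" "A \<noteq> B" "A \<noteq> C" "B \<noteq> C"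
      by (auto simp: card_3_iff)
    have "maximal_subgroup_of G A K \<and> finite A" if "A \<in> T" for A
      using that T(1) conj_set_maximal[OF max] \<open>finite H\<close> by auto
    then show False
      using no_three_maximal_subgroups[OF op, of A K B C] ABC by auto
  qed
  \<comment> \<open>Infinitely many elements of \<open>K\<close> give the same conjugate.
    Translating them by \<open>inv y\<close> puts them into the normalizer, which is the finite
    group \<open>H\<close>.\<close>
  then obtain y where y: "y \<in> K" "infinite {x\<in>K. conj_set x H = conj_set y H}"
    using pigeonhole_infinite[OF inf] by blast
  have "inj_on (\<lambda>x. inv y \<otimes> x) {x\<in>K. conj_set x H = conj_set y H}"
    using y by (intro inj_onI) simp
  moreover have "(\<lambda>x. inv y \<otimes> x) ` {x\<in>K. conj_set x H = conj_set y H} \<subseteq> ?N"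
  proof clarify
    fix x assume x: "x \<in> K" "conj_set x H = conj_set y H"
    have "conj_set (inv y \<otimes> x) H = conj_set (inv y) (conj_set x H)"
      using x y HK by (intro conj_set_mult) (auto dest: subgroup.subset)
    also have "\<dots> = H"
      using x y HK conj_set_inv(1)[of y H] by (auto dest: subgroup.subset)
    finally show "inv y \<otimes> x \<in> K \<and> conj_set (inv y \<otimes> x) H = H"
      using x y by simp
  qed
  ultimately have "finite {x\<in>K. conj_set x H = conj_set y H}"
    using \<open>finite H\<close> unfolding N by (rule inj_on_finite)
  with y(2) show False by contradiction
qed

text \<open>Along an edge, finiteness passes upwards by \<open>finite_if_maximal_finite\<close> and
  downwards to subsets.\<close>

lemma finite_if_connected:
  assumes "outer_planar V (subgroup_graph_edges G)"
    and "graph_connected (subgroup_graph_vertices G) (subgroup_graph_edges G)"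
  shows "finite (carrier G)"
proof -
  have "(\<lambda>x y. {x, y} \<in> subgroup_graph_edges G)\<^sup>*\<^sup>* {\<one>} (carrier G)"
    using assms(2) triv_subgroup subgroup_self
    by (auto simp: graph_connected_def subgroup_graph_vertices_def)
  then show ?thesis
  proof induction
    case (step H K)
    then have "maximal_subgroup_of G H K \<or> K \<subseteq> H"
      by (auto simp: subgroup_graph_edges_iff maximal_subgroup_of_def)
    then show ?case
      using finite_if_maximal_finite[OF assms(1)] step.IH finite_subset by blast
  qed simp
qed

text \<open>A group is not the union of two proper subgroups, so some element avoids the at most two
  maximal subgroups.\<close>

lemma cyclic_if_outer_planar:
  assumes op: "outer_planar V (subgroup_graph_edges G)" and fin: "finite (carrier G)"
  obtains g where "g \<in> carrier G" "generate G {g} = carrier G"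
proof (rule ccontr)
  assume "\<not> thesis"
  then have *: "\<exists>M. maximal_subgroup_of G M (carrier G) \<and> x \<in> M" if "x \<in> carrier G" for x
  proof -
    have "generate G {x} \<subset> carrier G"
      using that \<open>\<not> thesis\<close> \<open>\<And>g. g \<in> carrier G \<Longrightarrow> generate G {g} = carrier G \<Longrightarrow> thesis\<close>
        generate_incl[of "{x}"] by blast
    moreover have "subgroup (generate G {x}) G"
      using that by (intro generate_is_subgroup) simp
    ultimately obtain M where "maximal_subgroup_of G M (carrier G)" "generate G {x} \<subseteq> M"
      using exists_maximal_subgroup_above fin subgroup_self by blast
    then show "\<exists>M. maximal_subgroup_of G M (carrier G) \<and> x \<in> M"
      using generate.incl[of x "{x}" G] by blast
  qed
  have M: "subgroup M G" "M \<subset> carrier G" "finite M" if "maximal_subgroup_of G M (carrier G)" for M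
    using that fin by (auto simp: maximal_subgroup_of_def intro: finite_subset)
  obtain M1 where M1: "maximal_subgroup_of G M1 (carrier G)"
    using *[of \<one>] by blast
  obtain x where x: "x \<in> carrier G" "x \<notin> M1"
    using M(2)[OF M1] by blast
  obtain M2 where M2: "maximal_subgroup_of G M2 (carrier G)" "x \<in> M2"
    using *[OF x(1)] by blast
  obtain y where y: "y \<in> M1" "y \<notin> M2"
    using maximal_subgroup_of_antichain[OF M1 M2(1)] M2(2) x(2) by blast
  then have yG: "y \<in> carrier G"
    using M(2)[OF M1] by blast
  \<comment> \<open>Here \<open>x\<close> is in \<open>M2\<close> but not in \<open>M1\<close>, and
    \<open>y\<close> is in \<open>M1\<close> but not in \<open>M2\<close>; so their product is in
    neither, and \<open>M3\<close> is a third maximal subgroup.\<close>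
  obtain M3 where M3: "maximal_subgroup_of G M3 (carrier G)" "x \<otimes> y \<in> M3"
    using *[of "x \<otimes> y"] x yG by blast
  have "x \<otimes> y \<notin> M1"
    using x y yG subgroup.m_inv_closed[OF M(1)[OF M1] y(1)]
      subgroup.m_closed[OF M(1)[OF M1], of "x \<otimes> y" "inv y"] by (auto simp: m_assoc)
  moreover have "x \<otimes> y \<notin> M2"
    using x y yG subgroup.m_inv_closed[OF M(1)[OF M2(1)] M2(2)]
      subgroup.m_closed[OF M(1)[OF M2(1)], of "inv x" "x \<otimes> y"] by (auto simp: m_assoc[symmetric])
  ultimately show False
    using no_three_maximal_subgroups[OF op M1 M2(1) M3(1)] M(3) M1 M2 M3 x by metis
qed

text \<open>The map is exponentiation of \<open>g\<close>. Since \<open>ord g\<close> is the order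
  of \<open>G\<close>, it depends only on the residue of the exponent and separates
  residues.\<close>

lemma iso_integer_mod_group:
  assumes fin: "finite (carrier G)" and g: "g \<in> carrier G" "generate G {g} = carrier G"
  shows "G \<cong> integer_mod_group (order G)"
proof -
  let ?Z = "integer_mod_group (order G)" and ?f = "\<lambda>k::int. g [^] k"
  have n: "ord g = order G" "order G > 0"
    using generate_pow_card[OF g(1)] g(2) fin order_gt_0_iff_finite by (auto simp: order_def)
  \<comment> \<open>Positivity of the order matters: \<open>integer_mod_group 0\<close> is the group
    of all integers.\<close>
  then have Z: "carrier ?Z = {0..<int (order G)}"
    by (simp add: carrier_integer_mod_group)
  have mod: "?f (k mod int (order G)) = ?f k" for k
    using g(1) n by (simp add: int_pow_eq)
  have "?f \<in> hom ?Z G"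
    using g(1) mod by (intro homI) (auto simp: int_pow_mult)
  moreover have "inj_on ?f (carrier ?Z)"
    using g(1) n unfolding Z by (intro inj_onI) (auto simp: int_pow_eq dest: mod_eq_dvd_iff[THEN iffD2])
  moreover have "?f ` carrier ?Z = carrier G"
  proof
    show "carrier G \<subseteq> ?f ` carrier ?Z"
    proof
      fix x assume "x \<in> carrier G"
      then obtain k :: int where "x = g [^] k"
        using g generate_pow[OF g(1)] by blast
      then have "x = ?f (k mod int (order G))"
        using mod by simp
      then show "x \<in> ?f ` carrier ?Z"
        unfolding Z using n(2) by auto
    qed
  qed (use g(1) in auto)
  ultimately have "?Z \<cong> G"
    by (auto simp: iso_def bij_betw_def intro!: is_isoI)
  then show ?thesis
    using group.iso_sym[OF group_integer_mod_group] by blast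
qed

section \<open>Orders and indices of subgroups\<close>

lemma card_subgroup_dvd:
  assumes "subgroup A G" "subgroup B G" "A \<subseteq> B"
  shows "card A dvd card B"
proof -
  interpret B: group "G\<lparr>carrier := B\<rparr>"
    using assms(2) subgroup_imp_group by blast
  have "subgroup A (G\<lparr>carrier := B\<rparr>)"
    using subgroup_incl assms by blast
  then show ?thesis
    using B.lagrange[of A] by (simp add: order_def) (metis dvd_triv_right)
qed

text \<open>By Lagrange, a subgroup strictly in between would split the index \<open>p\<close> into
  two factors greater than 1.\<close>

lemma maximal_subgroup_of_prime_index:
  fixes p :: nat
  assumes "subgroup A G" "subgroup B G" "A \<subseteq> B" "finite B"
    and "card B = p * card A" "Factorial_Ring.prime p"
  shows "maximal_subgroup_of G A B"
  unfolding maximal_subgroup_of_def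
proof (intro conjI assms notI)
  have "card A > 0"
    using assms subgroup.finite_imp_card_positive finite_subset subgroup.subset[OF assms(1)]
      subgroup.one_closed[OF assms(1)] by (metis card_gt_0_iff empty_iff)
  then have "card A \<noteq> card B"
    using assms(5) prime_gt_1_nat[OF assms(6)] by auto
  then show "A \<subset> B" using assms(3) by blast
  assume "\<exists>L. subgroup L G \<and> A \<subset> L \<and> L \<subset> B"
  then obtain L where L: "subgroup L G" "A \<subset> L" "L \<subset> B" by blast
  obtain k l where k: "card L = card A * k" and l: "card B = card L * l"
    using card_subgroup_dvd assms L by (metis dvd_def psubset_imp_subset)
  then have "p = k * l"
    using assms(5) \<open>card A > 0\<close> by simp
  then have "k = 1 \<or> l = 1"
    using assms(6) prime_product by blast
  moreover have "card A < card L" "card L < card B"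
    using L assms(4) by (auto intro!: psubset_card_mono elim: finite_subset[rotated])
  ultimately show False
    using k l by auto
qed

end

section \<open>Finite cyclic groups\<close>

locale finite_cyclic_group = group +
  fixes g
  assumes finite_carrier: "finite (carrier G)"
    and g_closed: "g \<in> carrier G" and generate_g: "generate G {g} = carrier G"
begin

text \<open>The name follows additive notation: the exponents occurring are the multiples of
  \<open>d\<close>. When \<open>d\<close> divides the order, this is the subgroup of index
  \<open>d\<close>.\<close>

definition multiples :: "nat \<Rightarrow> 'a set" where
  "multiples d = generate G {g [^] d}"

lemma subgroup_multiples: "subgroup (multiples d) G"
  unfolding multiples_def using g_closed by (intro generate_is_subgroup) simp

lemma finite_multiples: "finite (multiples d)"
  using finite_subset[OF subgroup.subset[OF subgroup_multiples] finite_carrier] .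

lemma ord_g: "ord g = order G"
  using generate_pow_card[OF g_closed] generate_g by (simp add: order_def)

lemma order_pos: "order G > 0"
  using finite_carrier order_gt_0_iff_finite by blast

lemma card_multiples:
  assumes "d dvd order G"
  shows "card (multiples d) = order G div d"
proof -
  have "d \<noteq> 0" using assms order_pos by (metis dvd_0_left_iff not_gr_zero)
  then show ?thesis
    using generate_pow_card[of "g [^] d"] ord_pow[OF g_closed, of d] assms g_closed
    by (simp add: multiples_def ord_g)
qed

lemma multiples_inj:
  assumes "d dvd order G" "e dvd order G" "multiples d = multiples e"
  shows "d = e"
proof -
  have "order G div d = order G div e"
    using assms card_multiples by metis
  then show ?thesis
    using assms(1,2) order_pos by (metis div_div_eq_right dvd_div_eq_mult dvd_mult_div_cancel
        mult_cancel2 mult.commute not_gr_zero mult_eq_0_iff)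
qed

lemma multiples_antimono:
  assumes "d dvd e"
  shows "multiples e \<subseteq> multiples d"
proof -
  obtain k where "e = d * k" using assms by blast
  then have "g [^] e = (g [^] d) [^] int k"
    using g_closed by (simp add: nat_pow_pow int_pow_int)
  then have "g [^] e \<in> multiples d"
    unfolding multiples_def using generate_pow[of "g [^] d"] g_closed by blast
  then show ?thesis
    unfolding multiples_def[of e] by (intro generate_subgroup_incl subgroup_multiples) simp
qed

lemma maximal_multiples:
  assumes "Factorial_Ring.prime p" "d * p dvd order G"
  shows "maximal_subgroup_of G (multiples (d * p)) (multiples d)"
proof (rule maximal_subgroup_of_prime_index[OF _ _ _ _ _ assms(1)])
  obtain k where k: "order G = d * p * k"
    using assms(2) by blast
  then have "d > 0" "p > 0" using order_pos by (auto intro: Nat.gr0I)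
  moreover have "card (multiples (d * p)) = order G div (d * p)" "card (multiples d) = order G div d"
    using assms(2) by (auto intro!: card_multiples elim: dvd_mult_left)
  ultimately show "card (multiples d) = p * card (multiples (d * p))"
    using k by (simp add: mult.assoc)
qed (simp_all add: subgroup_multiples finite_multiples multiples_antimono)

lemma multiples_1: "multiples 1 = carrier G"
  using generate_g g_closed by (simp add: multiples_def)

text \<open>Distinct prime divisors of the order are indices of distinct maximal subgroups of
  \<open>carrier G\<close>.\<close>

lemma no_three_prime_divisors:
  assumes "outer_planar V (subgroup_graph_edges G)"
    and "Factorial_Ring.prime p" "Factorial_Ring.prime q" "Factorial_Ring.prime r"
    and "p dvd order G" "q dvd order G" "r dvd order G" "p \<noteq> q" "p \<noteq> r" "q \<noteq> r"
  shows False
proof -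
  have "maximal_subgroup_of G (multiples p) (carrier G)"
    "maximal_subgroup_of G (multiples q) (carrier G)"
    "maximal_subgroup_of G (multiples r) (carrier G)"
    using maximal_multiples[of p 1] maximal_multiples[of q 1] maximal_multiples[of r 1] assms
    by (simp_all add: multiples_1[unfolded One_nat_def])
  from no_three_maximal_subgroups[OF assms(1) this] show False
    using assms multiples_inj finite_multiples by metis
qed

text \<open>The subgroups of index \<open>p ^ i * q ^ j\<close> with \<open>i, j \<le> 2\<close> form a 3 by 3 grid. Its middle row
  and its two boundary arcs join the midpoints of two opposite sides.\<close>

lemma no_two_prime_square_divisors:
  assumes op: "outer_planar V (subgroup_graph_edges G)"
    and p: "Factorial_Ring.prime p" and q: "Factorial_Ring.prime q" and "p \<noteq> q"
    and dvd: "p\<^sup>2 * q\<^sup>2 dvd order G"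
  shows False
proof -
  let ?E = "subgroup_graph_edges G"
  define h where "h i j = multiples (p ^ i * q ^ j)" for i j :: nat
  have d: "p ^ i * q ^ j dvd order G" if "i \<le> 2" "j \<le> 2" for i j
    using dvd_trans[OF mult_dvd_mono[OF le_imp_power_dvd le_imp_power_dvd] dvd] that by blast
  have inj: "h i j = h k l \<longleftrightarrow> i = k \<and> j = l" if "i \<le> 2" "j \<le> 2" "k \<le> 2" "l \<le> 2" for i j k l
  proof
    assume "h i j = h k l"
    then have "p ^ i * q ^ j = p ^ k * q ^ l"
      using multiples_inj d that unfolding h_def by blast
    \<comment> \<open>Both exponents are recovered as multiplicities, so the nine points of the grid
      are distinct.\<close>
    moreover have "multiplicity p (p ^ a * q ^ b) = a" "multiplicity q (p ^ a * q ^ b) = b" for a b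
      using p q \<open>p \<noteq> q\<close> by (simp_all add: prime_elem_multiplicity_mult_distrib
          prime_multiplicity_other prime_elem_multiplicity_power_distrib multiplicity_distinct_prime_power)
    ultimately show "i = k \<and> j = l" by metis
  qed simp
  have E1: "{h i j, h (Suc i) j} \<in> ?E" "{h (Suc i) j, h i j} \<in> ?E" if "i < 2" "j \<le> 2" for i j
    using maximal_multiples[OF p, of "p ^ i * q ^ j"] d[of "Suc i" j] that
    by (auto simp: subgroup_graph_edges_iff h_def mult_ac)
  have E2: "{h i j, h i (Suc j)} \<in> ?E" "{h i (Suc j), h i j} \<in> ?E" if "i \<le> 2" "j < 2" for i j
    using maximal_multiples[OF q, of "p ^ i * q ^ j"] d[of i "Suc j"] that
    by (auto simp: subgroup_graph_edges_iff h_def mult_ac)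
  let ?S1 = "{h 1 0, h 0 0, h 0 1, h 0 2, h 1 2}" and ?S2 = "{h 1 0, h 1 1, h 1 2}"
    and ?S3 = "{h 1 0, h 2 0, h 2 1, h 2 2, h 1 2}"
  have "h 1 0 \<noteq> h 1 2" by (simp add: inj)
  \<comment> \<open>The middle point \<open>h 1 1\<close> lies strictly between the two ends of the
    theta, so these are not adjacent.\<close>
  moreover have "h 1 1 \<subset> h 1 0" "h 1 2 \<subset> h 1 1"
    using E2[of 1 0] E2[of 1 1] inj[of 1 1 1 0] inj[of 1 2 1 1]
    by (auto simp: h_def numeral_2_eq_2 intro!: psubsetI multiples_antimono mult_dvd_mono)
  then have "{h 1 2, h 1 0} \<notin> ?E"
    using subgroup_multiples not_edge_if_between[of "h 1 1" G] unfolding h_def by blast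
  then have "{h 1 0, h 1 2} \<notin> ?E" by (simp add: insert_commute)
  moreover have "reachable_in ?E ?S1 (h 1 0) (h 1 2)"
    using E1[of 0 0] E2[of 0 0] E2[of 0 1] E1[of 0 2]
    by (intro reachable_in_step[of "h 1 0" "h 0 0"] reachable_in_step[of "h 0 0" "h 0 1"]
        reachable_in_step[of "h 0 1" "h 0 2"] reachable_in_step[of "h 0 2" "h 1 2"]
        rtranclp.rtrancl_refl) (simp_all add: numeral_2_eq_2)
  moreover have "reachable_in ?E ?S2 (h 1 0) (h 1 2)"
    using E2[of 1 0] E2[of 1 1]
    by (intro reachable_in_step[of "h 1 0" "h 1 1"] reachable_in_step[of "h 1 1" "h 1 2"]
        rtranclp.rtrancl_refl) (simp_all add: numeral_2_eq_2)
  moreover have "reachable_in ?E ?S3 (h 1 0) (h 1 2)"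
    using E1[of 1 0] E2[of 2 0] E2[of 2 1] E1[of 1 2]
    by (intro reachable_in_step[of "h 1 0" "h 2 0"] reachable_in_step[of "h 2 0" "h 2 1"]
        reachable_in_step[of "h 2 1" "h 2 2"] reachable_in_step[of "h 2 2" "h 1 2"]
        rtranclp.rtrancl_refl) (simp_all add: numeral_2_eq_2)
  moreover have "?S1 \<inter> ?S2 \<subseteq> {h 1 0, h 1 2}" by (simp add: inj)
  moreover have "?S1 \<inter> ?S3 \<subseteq> {h 1 0, h 1 2}" by (simp add: inj)
  moreover have "?S2 \<inter> ?S3 \<subseteq> {h 1 0, h 1 2}" by (simp add: inj)
  ultimately have "\<not> outer_planar V ?E"
    by (rule not_outer_planar_if_theta)
  with op show False by contradiction
qed

end

section \<open>Arithmetic of the order and conclusion\<close>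

lemma prime_power_times_prime:
  fixes n :: nat
  assumes "n > 0"
    and three: "\<And>p q r. Factorial_Ring.prime p \<Longrightarrow> Factorial_Ring.prime q \<Longrightarrow> Factorial_Ring.prime r \<Longrightarrow>
      p dvd n \<Longrightarrow> q dvd n \<Longrightarrow> r dvd n \<Longrightarrow> p \<noteq> q \<Longrightarrow> p \<noteq> r \<Longrightarrow> q \<noteq> r \<Longrightarrow> False"
    and squares: "\<And>p q. Factorial_Ring.prime p \<Longrightarrow> Factorial_Ring.prime q \<Longrightarrow> p \<noteq> q \<Longrightarrow>
      \<not> p\<^sup>2 * q\<^sup>2 dvd n"
  obtains p q m where "Factorial_Ring.prime p" "Factorial_Ring.prime q" "p \<noteq> q"
    "n = p ^ m \<or> n = p ^ m * q"
proof (cases "n = 1")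
  case True
  then show thesis using that[of 2 3 0] by simp
next
  case False
  have split: "\<exists>k. n' = p ^ multiplicity p n' * k \<and> \<not> p dvd k \<and> multiplicity p n' > 0 \<and> k > 0"
    if "Factorial_Ring.prime p" "p dvd n'" "n' > 0" for p n' :: nat
  proof -
    have "\<not> is_unit p" using that(1) by (meson not_prime_unit)
    then obtain k where "n' = p ^ multiplicity p n' * k" "\<not> p dvd k"
      using multiplicity_decompose'[of n' p] \<open>n' > 0\<close> by (metis not_gr_zero)
    moreover have "multiplicity p n' > 0"
      using that by (simp add: prime_multiplicity_gt_zero_iff)
    ultimately show ?thesis
      using \<open>n' > 0\<close> by (metis dvd_0_right not_gr_zero)
  qed
  obtain p where p: "Factorial_Ring.prime p" "p dvd n"
    using False prime_factor_nat by blast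
  obtain a k where a: "n = p ^ a * k" "\<not> p dvd k" "a > 0" "k > 0"
    using split[OF p \<open>n > 0\<close>] by blast
  show thesis
  proof (cases "k = 1")
    case True
    \<comment> \<open>The conclusion names a second prime even for a prime power; one of 2 and 3
      differs from \<open>p\<close>.\<close>
    have "Factorial_Ring.prime (3::nat)" by simp
    obtain q where "Factorial_Ring.prime q" "p \<noteq> q"
      using two_is_prime_nat \<open>Factorial_Ring.prime (3::nat)\<close>
      by (metis numeral_eq_iff semiring_norm(88) semiring_norm(89))
    then show thesis using that[of p q a] p a True by simp
  next
    case False
    then obtain q where q: "Factorial_Ring.prime q" "q dvd k"
      using prime_factor_nat by blast
    obtain b l where b: "k = q ^ b * l" "\<not> q dvd l" "b > 0" "l > 0"
      using split[OF q \<open>k > 0\<close>] by blast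
    have "p \<noteq> q" using a(2) q(2) by blast
    \<comment> \<open>A prime divisor of \<open>l\<close> would be a third prime divisor of
      \<open>n\<close>.\<close>
    have "l = 1"
    proof (rule ccontr)
      assume "l \<noteq> 1"
      then obtain r where r: "Factorial_Ring.prime r" "r dvd l"
        using prime_factor_nat by blast
      then have "r \<noteq> p" "r \<noteq> q" "r dvd n" "q dvd n"
        using a(1,2) b(1,2) q(2) by auto
      then show False
        using three[OF p(1) q(1) r(1) p(2)] \<open>p \<noteq> q\<close> by metis
    qed
    then have n: "n = p ^ a * q ^ b" using a b by simp
    have "a = 1 \<or> b = 1"
    proof (rule ccontr)
      assume "\<not> ?thesis"
      then have "2 \<le> a" "2 \<le> b" using a(3) b(3) by auto
      then have "p\<^sup>2 * q\<^sup>2 dvd n"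
        unfolding n by (intro mult_dvd_mono le_imp_power_dvd)
      then show False using squares p(1) q(1) \<open>p \<noteq> q\<close> by blast
    qed
    \<comment> \<open>The prime with exponent 1 takes the place of \<open>q\<close>, so the two
      primes may have to be swapped.\<close>
    then show thesis
      using that[of p q a] that[of q p b] p(1) q(1) \<open>p \<noteq> q\<close> n by (auto simp: mult.commute)
  qed
qed

theorem theorem4p1:
  fixes G :: "('a, 'b) monoid_scheme"
  assumes "group G"
    and "graph_connected (subgroup_graph_vertices G) (subgroup_graph_edges G)"
    and "outer_planar (subgroup_graph_vertices G) (subgroup_graph_edges G)"
  shows "\<exists>p q m. Factorial_Ring.prime (p::nat) \<and> Factorial_Ring.prime q \<and> p \<noteq> q \<and>
           (G \<cong> integer_mod_group (p ^ m) \<or> G \<cong> integer_mod_group (p ^ m * q))"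
proof -
  interpret group G by fact
  have fin: "finite (carrier G)"
    using finite_if_connected[OF assms(3,2)] .
  obtain g where g: "g \<in> carrier G" "generate G {g} = carrier G"
    using cyclic_if_outer_planar[OF assms(3) fin] .
  interpret finite_cyclic_group G g
    using fin g by unfold_locales
  obtain p q m where pq: "Factorial_Ring.prime p" "Factorial_Ring.prime q" "p \<noteq> q"
      and "order G = p ^ m \<or> order G = p ^ m * q"
    using prime_power_times_prime[OF order_pos no_three_prime_divisors[OF assms(3)]
        notI[OF no_two_prime_square_divisors[OF assms(3)]]] .
  then have "G \<cong> integer_mod_group (p ^ m) \<or> G \<cong> integer_mod_group (p ^ m * q)"
    using iso_integer_mod_group[OF fin g] by (elim disjE) simp_all
  with pq show ?thesis by blast
qed

end
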